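(* Let $n \in \mathbb{N}$ with $n \geq 2$ and let $\mathcal{F} \subseteq \mathcal{P}([n])$ be a nontrivial, union closed family with $m = \#\mathcal{F}$ satisfying $m \geq \frac{7n}{\log_2 n}$. Then there is an $x \in [n]$ with $$\#\{F \in \mathcal{F} : x \in F\} \geq \frac{\sqrt{\log_2 n}}{3n} \cdot \#\mathcal{F}.$$
   Context: $[n] = \{1,\dots,n\}$, $\mathcal{P}([n])$ its power set, $\#X$ the cardinality. $\mathcal{F}$ is nontrivial if $\bigcup_{F \in \mathcal{F}} F = [n]$ and union closed if $A, B \in \mathcal{F}$ implies $A \cup B \in \mathcal{F}$. *)

theory Defs
  imports Complex_Main
begin

definition nontrivial_family :: "nat \<Rightarrow> nat set set \<Rightarrow> bool" where
  "nontrivial_family n \<F> \<longleftrightarrow> (\<Union>F\<in>\<F>. F) = {1..n}"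

definition union_closed :: "'a set set \<Rightarrow> bool" where
  "union_closed \<F> \<longleftrightarrow> (\<forall>A\<in>\<F>. \<forall>B\<in>\<F>. A \<union> B \<in> \<F>)"

end

theory Submission
  imports Defs "HOL-Analysis.Harmonic_Numbers"
begin

text \<open>
  Let every element have degree at most \<open>D\<close> and put \<open>s = sqrt (log 2 n)\<close>. A minimal transversal
  \<open>S\<close> of the nonempty members satisfies \<open>2 ^ card S \<le> m + 1\<close>, because every nonempty subset of
  \<open>S\<close> is the trace of a union of members; hence \<open>m - 1 \<le> D * log 2 (m + 1)\<close> (Knill's bound). So if
  \<open>D\<close> is too small, then \<open>ln m\<close> exceeds about \<open>1.7 n / s\<close>. On the other hand a family of average size
  \<open>a\<close> satisfies \<open>ln m \<le> L a + n exp (- L)\<close> for every \<open>L\<close>; with \<open>L = ln s\<close> and \<open>a \<le> s / 3\<close> this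
  gives \<open>ln m \<le> s\<^sup>2 / 3 + n / s\<close>, which is smaller.
\<close>

lemma sum_card_eq_sum_degree:
  assumes "finite A" "\<F> \<subseteq> Pow A"
  shows "(\<Sum>F\<in>\<F>. card F) = (\<Sum>x\<in>A. card {F \<in> \<F>. x \<in> F})"
proof -
  have "(\<Sum>F\<in>\<F>. card F) = (\<Sum>F\<in>\<F>. card {x \<in> A. x \<in> F})"
    using assms(2) by (intro sum.cong refl arg_cong[where f=card]) blast
  also have "\<dots> = (\<Sum>x\<in>A. card {F \<in> \<F>. x \<in> F})"
    using assms by (intro sum_multicount_gen) (auto intro: finite_subset)
  finally show ?thesis .
qed

lemma union_closed_Union:
  assumes "union_closed \<F>" "finite \<G>" "\<G> \<noteq> {}" "\<G> \<subseteq> \<F>"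
  shows "\<Union>\<G> \<in> \<F>"
  using assms(2-4)
proof (induction \<G> rule: finite_ne_induct)
  case (insert G \<G>)
  then show ?case using assms(1) by (auto simp: union_closed_def)
qed auto

definition transversal :: "'a set set \<Rightarrow> 'a set \<Rightarrow> bool" where
  "transversal \<F> S \<longleftrightarrow> (\<forall>F\<in>\<F>. F \<noteq> {} \<longrightarrow> F \<inter> S \<noteq> {})"

text \<open>Take a transversal \<open>S\<close> of least cardinality. Removing \<open>s\<close>
  leaves some nonempty member unmet, and that member can meet \<open>S\<close> in \<open>s\<close>
  alone.\<close>

lemma minimal_transversal_private_members:
  assumes "finite A" "\<F> \<subseteq> Pow A"
  obtains S where "S \<subseteq> A" "transversal \<F> S" "\<And>s. s \<in> S \<Longrightarrow> \<exists>F\<in>\<F>. F \<inter> S = {s}"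
proof -
  let ?P = "\<lambda>S. S \<subseteq> A \<and> transversal \<F> S"
  have "?P A" using assms(2) by (auto simp: transversal_def)
  then obtain S where S: "?P S" and min: "\<And>T. ?P T \<Longrightarrow> card S \<le> card T"
    using ex_has_least_nat[of ?P A card] by blast
  have "\<exists>F\<in>\<F>. F \<inter> S = {s}" if "s \<in> S" for s
  proof -
    have "finite S" using S assms(1) finite_subset by blast
    then have "card (S - {s}) < card S" using that by (meson card_Diff1_less)
    then have "\<not> transversal \<F> (S - {s})" using min[of "S - {s}"] S by auto
    then obtain F where F: "F \<in> \<F>" "F \<noteq> {}" "F \<inter> (S - {s}) = {}"
      by (auto simp: transversal_def)
    with S have "F \<inter> S \<noteq> {}" by (auto simp: transversal_def)
    with F show ?thesis by blast
  qed
  with S show ?thesis using that by blast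
qed

text \<open>Uniting the private members of the elements of \<open>T\<close> gives a member with
  trace exactly \<open>T\<close> on \<open>S\<close>. The summand 1 pays for \<open>T = {}\<close>,
  which need not be a trace.\<close>

lemma two_power_card_le_of_private_members:
  assumes "union_closed \<F>" "finite \<F>" "finite S" "\<And>s. s \<in> S \<Longrightarrow> \<exists>F\<in>\<F>. F \<inter> S = {s}"
  shows "2 ^ card S \<le> card \<F> + 1"
proof -
  from assms(4) obtain f where f: "\<And>s. s \<in> S \<Longrightarrow> f s \<in> \<F> \<and> f s \<inter> S = {s}"
    by metis
  have "Pow S - {{}} \<subseteq> (\<lambda>F. F \<inter> S) ` \<F>"
  proof
    fix T assume T: "T \<in> Pow S - {{}}"
    then have "finite T" using assms(3) finite_subset by blast
    then have "\<Union>(f ` T) \<in> \<F>" using T f by (intro union_closed_Union[OF assms(1)]) auto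
    moreover have "\<Union>(f ` T) \<inter> S = T"
    proof -
      have "\<Union>(f ` T) \<inter> S = (\<Union>s\<in>T. f s \<inter> S)" by blast
      also have "\<dots> = (\<Union>s\<in>T. {s})" using T f by (intro SUP_cong) auto
      finally show ?thesis by simp
    qed
    ultimately show "T \<in> (\<lambda>F. F \<inter> S) ` \<F>" by (metis imageI)
  qed
  then have "card (Pow S - {{}}) \<le> card \<F>" using assms(2) by (rule surj_card_le[rotated])
  then show ?thesis using assms(3) by (simp add: card_Pow card_Diff_singleton)
qed

lemma Knill_bound:
  fixes D :: real
  assumes "finite A" "\<F> \<subseteq> Pow A" "union_closed \<F>" "D \<ge> 0"
    and deg: "\<And>x. x \<in> A \<Longrightarrow> real (card {F \<in> \<F>. x \<in> F}) \<le> D"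
  shows "real (card \<F>) - 1 \<le> log 2 (real (card \<F>) + 1) * D"
proof -
  have fin: "finite \<F>" using assms(1,2) finite_subset by auto
  obtain S where S: "S \<subseteq> A" "transversal \<F> S" "\<And>s. s \<in> S \<Longrightarrow> \<exists>F\<in>\<F>. F \<inter> S = {s}"
    using minimal_transversal_private_members[OF assms(1,2)] by blast
  have finS: "finite S" using S(1) assms(1) finite_subset by blast
  have "2 ^ card S \<le> card \<F> + 1"
    by (rule two_power_card_le_of_private_members[OF assms(3) fin finS S(3)])
  then have "(2::real) ^ card S \<le> real (card \<F>) + 1"
    by (metis (mono_tags, lifting) of_nat_1 of_nat_add of_nat_le_iff of_nat_numeral of_nat_power)
  then have cS: "real (card S) \<le> log 2 (real (card \<F>) + 1)"
    by (intro le_log_of_power) auto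
  have "card \<F> - 1 \<le> card (\<F> - {{}})" by (simp add: card_Diff_singleton_if)
  \<comment> \<open>As \<open>S\<close> is a transversal, the \<open>card S\<close> stars of its
    elements, each of size at most \<open>D\<close>, cover all nonempty members.\<close>
  also have "\<F> - {{}} \<subseteq> (\<Union>s\<in>S. {F \<in> \<F>. s \<in> F})"
    using S(2) by (fastforce simp: transversal_def)
  then have "card (\<F> - {{}}) \<le> card (\<Union>s\<in>S. {F \<in> \<F>. s \<in> F})"
    using fin finS by (intro card_mono) auto
  also have "\<dots> \<le> (\<Sum>s\<in>S. card {F \<in> \<F>. s \<in> F})" by (rule card_UN_le[OF finS])
  finally have "real (card \<F>) - 1 \<le> (\<Sum>s\<in>S. real (card {F \<in> \<F>. s \<in> F}))"
    by (simp flip: of_nat_sum)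
  also have "\<dots> \<le> real (card S) * D"
    using S(1) deg by (intro sum_bounded_above) auto
  also have "\<dots> \<le> log 2 (real (card \<F>) + 1) * D"
    using cS assms(4) by (rule mult_right_mono)
  finally show ?thesis .
qed

lemma sum_power_card_Pow:
  fixes q :: "'b::comm_semiring_1"
  assumes "finite A"
  shows "(\<Sum>F\<in>Pow A. q ^ card F) = (1 + q) ^ card A"
proof -
  have "(\<Prod>x\<in>A. q + 1) = (\<Sum>F\<in>Pow A. (\<Prod>x\<in>F. q) * (\<Prod>x\<in>A - F. 1))"
    by (rule prod_add[OF assms])
  then show ?thesis by (simp add: add.commute)
qed

text \<open>Jensen's inequality for the weights \<open>exp (- L * card F)\<close>, whose sum over all subsets is
  \<open>(1 + exp (- L)) ^ card A\<close>.\<close>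

lemma ln_card_le_average_size:
  fixes L :: real
  assumes "finite A" "\<F> \<subseteq> Pow A" "\<F> \<noteq> {}"
  defines "a \<equiv> real (\<Sum>F\<in>\<F>. card F) / real (card \<F>)"
  shows "ln (real (card \<F>)) \<le> L * a + real (card A) * exp (- L)"
proof -
  have fin: "finite \<F>" using assms(1,2) finite_subset by auto
  have pos: "real (card \<F>) > 0" using fin assms(3) by (simp add: card_gt_0_iff)
  \<comment> \<open>The left side is the tangent at \<open>a\<close> of the convex function
    \<open>exp (- L * k)\<close> of \<open>k\<close>. As \<open>a\<close> is the average size, the
    linear terms cancel when summed over the family.\<close>
  have tangent: "exp (- L * a) * (1 - L * (real k - a)) \<le> exp (- L) ^ k" for k :: nat
  proof -
    have "exp (- L * a) * (1 - L * (real k - a)) \<le> exp (- L * a) * exp (- (L * (real k - a)))"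
      using exp_ge_add_one_self[of "- (L * (real k - a))"] by (intro mult_left_mono) auto
    also have "\<dots> = exp (- L) ^ k"
      by (simp add: algebra_simps flip: exp_add exp_of_nat_mult)
    finally show ?thesis .
  qed
  have "(\<Sum>F\<in>\<F>. 1 - L * (real (card F) - a)) = real (card \<F>)"
    using pos by (simp add: sum_subtractf a_def flip: sum_distrib_left)
  then have "real (card \<F>) * exp (- L * a) = (\<Sum>F\<in>\<F>. exp (- L * a) * (1 - L * (real (card F) - a)))"
    by (simp flip: sum_distrib_left)
  also have "\<dots> \<le> (\<Sum>F\<in>\<F>. exp (- L) ^ card F)" by (intro sum_mono tangent)
  also have "\<dots> \<le> (\<Sum>F\<in>Pow A. exp (- L) ^ card F)" using assms(1,2) by (intro sum_mono2) auto
  also have "\<dots> = (1 + exp (- L)) ^ card A" by (rule sum_power_card_Pow[OF assms(1)])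
  also have "\<dots> \<le> exp (exp (- L)) ^ card A" by (intro power_mono) auto
  also have "\<dots> = exp (real (card A) * exp (- L))" by (rule exp_of_nat_mult[symmetric])
  finally have "ln (real (card \<F>) * exp (- L * a)) \<le> ln (exp (real (card A) * exp (- L)))"
    using pos by (subst ln_le_cancel_iff) auto
  then show ?thesis using pos by (simp add: ln_mult)
qed

text \<open>The quadratic Taylor bound for \<open>exp\<close> at \<open>2 / 3 * x\<close>, using
  \<open>ln 2 \<ge> 2 / 3\<close>; hence 2/9 is half the square of 2/3.\<close>

lemma two_powr_ge_quadratic:
  fixes x :: real
  assumes "x \<ge> 0"
  shows "1 + 2 / 3 * x + 2 / 9 * x\<^sup>2 \<le> 2 powr x"
proof -
  have le: "2 / 3 * x \<le> ln 2 * x" using ln2_ge_two_thirds assms by (intro mult_right_mono)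
  have "1 + 2 / 3 * x + 2 / 9 * x\<^sup>2 = 1 + 2 / 3 * x + (2 / 3 * x)\<^sup>2 / 2"
    by (simp add: power2_eq_square)
  also have "\<dots> \<le> exp (2 / 3 * x)" using assms by (intro exp_lower_Taylor_quadratic) auto
  also have "\<dots> \<le> exp (ln 2 * x)" using le by simp
  also have "\<dots> = 2 powr x" by (simp add: powr_def mult.commute)
  finally show ?thesis .
qed

lemma cubic_sqrt_log_less:
  fixes n :: real
  assumes "n \<ge> 1"
  defines "s \<equiv> sqrt (log 2 n)"
  shows "7 * s ^ 3 + 3 * s < 15 * n"
proof -
  have x: "s\<^sup>2 = log 2 n" and s0: "s \<ge> 0" using assms by auto
  \<comment> \<open>This removes the odd powers of \<open>s\<close>: what remains is a comparison of
    quadratics in \<open>s\<^sup>2\<close>, settled coefficient by coefficient.\<close>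
  have "s \<le> (4 + s\<^sup>2) / 4" using zero_le_power2[of "s - 2"] by (simp add: power2_diff)
  then have "(7 * s\<^sup>2 + 3) * s \<le> (7 * s\<^sup>2 + 3) * ((4 + s\<^sup>2) / 4)"
    by (intro mult_left_mono) auto
  also have "\<dots> < 15 * (1 + 2 / 3 * s\<^sup>2 + 2 / 9 * (s\<^sup>2)\<^sup>2)"
  proof -
    have "0 \<le> (s\<^sup>2)\<^sup>2" "0 \<le> s\<^sup>2" by simp_all
    moreover have "(7 * s\<^sup>2 + 3) * ((4 + s\<^sup>2) / 4) = 7 / 4 * (s\<^sup>2)\<^sup>2 + 31 / 4 * s\<^sup>2 + 3"
      by (simp add: power2_eq_square field_simps)
    ultimately show ?thesis by (simp only: distrib_left)
  qed
  also have "\<dots> \<le> 15 * 2 powr (s\<^sup>2)" by (intro mult_left_mono two_powr_ge_quadratic) auto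
  also have "\<dots> = 15 * n" using assms(1) by (simp add: x)
  finally show ?thesis by (simp add: algebra_simps power2_eq_square power3_eq_cube)
qed

theorem theorem3p14:
  fixes n m :: nat and \<F> :: "nat set set"
  assumes "n \<ge> 2"
    and "\<F> \<subseteq> Pow {1..n}"
    and "nontrivial_family n \<F>"
    and "union_closed \<F>"
    and "m = card \<F>"
    and "real m \<ge> 7 * real n / log 2 (real n)"
  shows "\<exists>x\<in>{1..n}. real (card {F \<in> \<F>. x \<in> F}) \<ge> sqrt (log 2 (real n)) / (3 * real n) * real (card \<F>)"
proof (rule ccontr)
  define s where "s = sqrt (log 2 (real n))"
  define D where "D = s / (3 * real n) * real m"
  assume "\<not> ?thesis"
  then have deg: "real (card {F \<in> \<F>. x \<in> F}) \<le> D" if "x \<in> {1..n}" for x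
    using that unfolding s_def D_def assms(5) by (meson linear)
  have n: "real n \<ge> 2" using assms(1) by simp
  have log1: "log 2 (real n) \<ge> 1" using n by (simp add: le_log_iff)
  then have s1: "s \<ge> 1" by (simp add: s_def)
  have D0: "D \<ge> 0" using s1 by (simp add: D_def)
  \<comment> \<open>The lower bound on \<open>m\<close> enters through its consequence
    \<open>m \<ge> 7\<close>, which controls the additive constants below.\<close>
  have "log 2 (real n) \<le> real n"
    using n of_nat_less_two_power[of n, where 'a=real] by (subst log_le_iff) (auto simp: powr_realpow)
  then have "7 * log 2 (real n) \<le> 7 * real n" by simp
  then have "7 \<le> 7 * real n / log 2 (real n)" using log1 assms(1) by (simp add: le_divide_eq)
  with assms(6) have m7: "real m \<ge> 7" by linarith
  have "real m - 1 \<le> log 2 (real m + 1) * D"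
    using Knill_bound[of "{1..n}" \<F> D] assms(2,4,5) D0 deg by auto
  also have "\<dots> \<le> 3 / 2 * ln (real m + 1) * D"
  proof (rule mult_right_mono[OF _ D0])
    have "ln (real m + 1) = log 2 (real m + 1) * ln 2" by (simp add: log_def)
    moreover have "log 2 (real m + 1) * (2 / 3) \<le> log 2 (real m + 1) * ln 2"
      using ln2_ge_two_thirds by (intro mult_left_mono) auto
    ultimately show "log 2 (real m + 1) \<le> 3 / 2 * ln (real m + 1)" by linarith
  qed
  \<comment> \<open>Here \<open>m \<ge> 7\<close> gives \<open>m - 1 \<ge> 6 / 7 * m\<close>, so
    that the factor \<open>m\<close> in \<open>D\<close> can be cancelled.\<close>
  finally have "6 / 7 * real m \<le> 3 / 2 * ln (real m + 1) * D" using m7 by linarith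
  then have "real m * (12 / 7 * real n) \<le> real m * (s * ln (real m + 1))"
    using n by (simp add: D_def field_simps)
  then have lower: "12 / 7 * real n \<le> s * ln (real m + 1)" using m7 by simp
  \<comment> \<open>Knill's bound involves \<open>m + 1\<close>, the average-size bound
    \<open>m\<close>; passing between them costs at most 1/7.\<close>
  have "ln (real m + 1) - ln (real m) \<le> 1 / real m"
    using ln_diff_le[of "real m + 1" "real m"] m7 by simp
  also have "\<dots> \<le> 1 / 7" using m7 by (simp add: field_simps)
  finally have ln_Suc: "ln (real m + 1) \<le> ln (real m) + 1 / 7" by simp
  define a where "a = real (\<Sum>F\<in>\<F>. card F) / real (card \<F>)"
  have "real (\<Sum>F\<in>\<F>. card F) = (\<Sum>x\<in>{1..n}. real (card {F \<in> \<F>. x \<in> F}))"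
    unfolding sum_card_eq_sum_degree[OF finite_atLeastAtMost assms(2)] by simp
  also have "\<dots> \<le> real (card {1..n}) * D" by (intro sum_bounded_above deg)
  also have "\<dots> = s / 3 * real m" using n by (simp add: D_def)
  finally have a: "a \<le> s / 3" using m7 assms(5) by (simp add: a_def divide_le_eq)
  have "\<F> \<noteq> {}" using m7 assms(5) by auto
  then have "ln (real m) \<le> ln s * a + real n * exp (- ln s)"
    using ln_card_le_average_size[of "{1..n}" \<F> "ln s"] assms(2,5) by (simp add: a_def)
  also have "ln s * a \<le> s * (s / 3)"
    using s1 a ln_bound[of s] by (intro mult_mono) (auto simp: a_def sum_nonneg)
  also have "exp (- ln s) = 1 / s" using s1 by (simp add: exp_minus inverse_eq_divide)
  finally have "ln (real m + 1) \<le> s * (s / 3) + real n * (1 / s) + 1 / 7" using ln_Suc by simp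
  then have "s * ln (real m + 1) \<le> s * (s * (s / 3) + real n * (1 / s) + 1 / 7)"
    using s1 by (intro mult_left_mono) auto
  also have "\<dots> = s ^ 3 / 3 + real n + s / 7"
    using s1 by (simp add: field_simps power3_eq_cube)
  \<comment> \<open>Multiplying \<open>12 / 7 * n \<le> s ^ 3 / 3 + n + s / 7\<close> by 21 leaves
    \<open>36 - 21 = 15\<close> as the coefficient of \<open>n\<close>.\<close>
  finally have "15 * real n \<le> 7 * s ^ 3 + 3 * s" using lower by simp
  moreover have "7 * s ^ 3 + 3 * s < 15 * real n"
    using cubic_sqrt_log_less[of "real n"] n by (simp add: s_def)
  ultimately show False by simp
qed

end
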